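(* Let $M \in \mathbb{Z}^+$, and for all integers $n \geq 1$ and $1 \leq m \leq M$ let $\xi_{n,m} : [-1,1] \to \mathbb{R}$ be a function such that $\max_{x} |\xi_{n,m}(x)| \leq 1$ and $\max_{x} |\xi_{n,m}'(x)| \leq b_{n,m}$, where $b_{n,m}$ is a constant not depending on $x$. Let $P_r$ and $P_g$ be probability distributions with support in $[-1,1]$. For real coefficients $A = (A_{n,m})_{n\ge 1,\,1\le m\le M}$ put $$f_{A,\xi}(x) = \sum_{n=1}^\infty \sum_{m=1}^M A_{n,m}\, \xi_{n,m}(x), \qquad \mathcal{L}_\xi(A) = \sum_{n=1}^\infty \sum_{m=1}^M |A_{n,m}|\, b_{n,m},$$ and $$J(A) = \mathbb{E}_{P_r}[f_{A,\xi}(X)] - \mathbb{E}_{P_g}[f_{A,\xi}(X)] = \sum_{n=1}^\infty \sum_{m=1}^M A_{n,m}\left(\mathbb{E}_{P_r}[\xi_{n,m}(X)] - \mathbb{E}_{P_g}[\xi_{n,m}(X)]\right).$$ Consider the optimization of the summable critic: maximize $J(A)$ over the parameter settings $A$ satisfying $\mathcal{L}_\xi(A) \leq 1$. Then any setting of the parameters that is a local maximum of this problem is also a global maximum of it.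
   Context: The functions $f_{A,\xi}$ are called summable critics. Their parameters are the real coefficients $A_{n,m}$, while $\xi_{n,m}$, $b_{n,m}$, $P_r$ and $P_g$ are held fixed. The series and expectations above are taken to be well defined for the parameter settings considered, so that $J$ is linear in $A$. The condition $\mathcal{L}_\xi(A)\le 1$ is the surrogate for the 1-Lipschitz constraint on the critic, since $|f_{A,\xi}'(x)| \le \mathcal{L}_\xi(A)$ for all $x\in[-1,1]$. A local maximum is a parameter setting $B^*$ with $\mathcal{L}_\xi(B^* )\le 1$ such that $J(A)\le J(B^* )$ for all $A$ sufficiently close to $B^*$ with $\mathcal{L}_\xi(A)\le 1$. A global maximum is such a $B^*$ with $J(A)\le J(B^* )$ for all $A$ with $\mathcal{L}_\xi(A)\le 1$. No particular topology on the parameters is singled out. Closeness is understood in a sense for which $\tfrac1t A + (1-\tfrac1t)B \to B$ as $t\to\infty$, for any parameter settings $A,B$. *)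

theory Defs
  imports "HOL-Probability.Probability"
begin

(* Coefficients A n m are indexed by n >= 1 and 1 <= m <= M; the sums below run over n = 0, 1, 2, ...
   with Suc n in place of n.  All sums over (n, m) are iterated: an infinite series over n of finite
   sums over m. *)

definition critic :: "nat \<Rightarrow> (nat \<Rightarrow> nat \<Rightarrow> real \<Rightarrow> real) \<Rightarrow> (nat \<Rightarrow> nat \<Rightarrow> real) \<Rightarrow> real \<Rightarrow> real" where
  "critic M \<xi> A x = (\<Sum>n. \<Sum>m=1..M. A (Suc n) m * \<xi> (Suc n) m x)"

definition lip_surrogate :: "nat \<Rightarrow> (nat \<Rightarrow> nat \<Rightarrow> real) \<Rightarrow> (nat \<Rightarrow> nat \<Rightarrow> real) \<Rightarrow> real" where
  "lip_surrogate M b A = (\<Sum>n. \<Sum>m=1..M. \<bar>A (Suc n) m\<bar> * b (Suc n) m)"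

(* The parameter settings for which the two series above converge.  Entries outside the index range
   carry no information and are pinned to 0, so that a setting is determined by its coefficients.
   Existence of the expectations and their termwise evaluation need not be required in addition:
   see integrable_critic and critic_objective_sums below. *)
definition critic_settings ::
    "nat \<Rightarrow> (nat \<Rightarrow> nat \<Rightarrow> real \<Rightarrow> real) \<Rightarrow> (nat \<Rightarrow> nat \<Rightarrow> real) \<Rightarrow> (nat \<Rightarrow> nat \<Rightarrow> real) set" where
  "critic_settings M \<xi> b = {A.
     (\<forall>n m. \<not> (1 \<le> n \<and> 1 \<le> m \<and> m \<le> M) \<longrightarrow> A n m = 0) \<and>
     (\<forall>x\<in>{-1..1}. summable (\<lambda>n. \<Sum>m=1..M. A (Suc n) m * \<xi> (Suc n) m x)) \<and>
     summable (\<lambda>n. \<Sum>m=1..M. \<bar>A (Suc n) m\<bar> * b (Suc n) m)}"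

(* Expectation of a function that is only meaningful on [-1,1], under a distribution P on the reals
   that is concentrated on [-1,1]. *)
definition expect :: "real measure \<Rightarrow> (real \<Rightarrow> real) \<Rightarrow> real" where
  "expect P g = (LINT x:{-1..1}|P. g x)"

definition critic_objective ::
    "nat \<Rightarrow> (nat \<Rightarrow> nat \<Rightarrow> real \<Rightarrow> real) \<Rightarrow> real measure \<Rightarrow> real measure \<Rightarrow> (nat \<Rightarrow> nat \<Rightarrow> real) \<Rightarrow> real" where
  "critic_objective M \<xi> P\<^sub>r P\<^sub>g A = expect P\<^sub>r (critic M \<xi> A) - expect P\<^sub>g (critic M \<xi> A)"

definition feasible_settings ::
    "nat \<Rightarrow> (nat \<Rightarrow> nat \<Rightarrow> real \<Rightarrow> real) \<Rightarrow> (nat \<Rightarrow> nat \<Rightarrow> real) \<Rightarrow> (nat \<Rightarrow> nat \<Rightarrow> real) set" where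
  "feasible_settings M \<xi> b = {A \<in> critic_settings M \<xi> b. lip_surrogate M b A \<le> 1}"

definition mix :: "real \<Rightarrow> (nat \<Rightarrow> nat \<Rightarrow> real) \<Rightarrow> (nat \<Rightarrow> nat \<Rightarrow> real) \<Rightarrow> nat \<Rightarrow> nat \<Rightarrow> real" where
  "mix s A B = (\<lambda>n m. s * A n m + (1 - s) * B n m)"

definition local_max_on :: "'a topology \<Rightarrow> 'a set \<Rightarrow> ('a \<Rightarrow> real) \<Rightarrow> 'a \<Rightarrow> bool" where
  "local_max_on T S J B \<longleftrightarrow>
     B \<in> S \<and> (\<exists>U. openin T U \<and> B \<in> U \<and> (\<forall>A\<in>U \<inter> S. J A \<le> J B))"

definition global_max_on :: "'a set \<Rightarrow> ('a \<Rightarrow> real) \<Rightarrow> 'a \<Rightarrow> bool" where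
  "global_max_on S J B \<longleftrightarrow> B \<in> S \<and> (\<forall>A\<in>S. J A \<le> J B)"

lemma mix_in_critic_settings:
  assumes A: "A \<in> critic_settings M \<xi> b" and B: "B \<in> critic_settings M \<xi> b"
    and b0: "\<And>n m. 1 \<le> n \<Longrightarrow> 1 \<le> m \<Longrightarrow> m \<le> M \<Longrightarrow> 0 \<le> b n m"
  shows "mix s A B \<in> critic_settings M \<xi> b"
proof -
  have 1: "summable (\<lambda>n. \<Sum>m=1..M. mix s A B (Suc n) m * \<xi> (Suc n) m x)"
    if x: "x \<in> {-1..1}" for x
  proof -
    have "summable (\<lambda>n. s * (\<Sum>m=1..M. A (Suc n) m * \<xi> (Suc n) m x)
        + (1 - s) * (\<Sum>m=1..M. B (Suc n) m * \<xi> (Suc n) m x))"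
      using A B x unfolding critic_settings_def
      by (intro summable_add summable_mult) auto
    then show ?thesis
      by (simp add: mix_def sum_distrib_left sum.distrib[symmetric] algebra_simps)
  qed
  have "summable (\<lambda>n. \<Sum>m=1..M. \<bar>mix s A B (Suc n) m\<bar> * b (Suc n) m)"
  proof (rule summable_comparison_test')
    show "summable (\<lambda>n. \<bar>s\<bar> * (\<Sum>m=1..M. \<bar>A (Suc n) m\<bar> * b (Suc n) m)
        + \<bar>1 - s\<bar> * (\<Sum>m=1..M. \<bar>B (Suc n) m\<bar> * b (Suc n) m))"
      using A B unfolding critic_settings_def by (intro summable_add summable_mult) auto
    fix n :: nat
    have "norm (\<Sum>m=1..M. \<bar>mix s A B (Suc n) m\<bar> * b (Suc n) m)
        = (\<Sum>m=1..M. \<bar>mix s A B (Suc n) m\<bar> * b (Suc n) m)"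
      unfolding real_norm_def by (intro abs_of_nonneg sum_nonneg mult_nonneg_nonneg b0) auto
    also have "\<dots> \<le> (\<Sum>m=1..M. (\<bar>s\<bar> * \<bar>A (Suc n) m\<bar> + \<bar>1 - s\<bar> * \<bar>B (Suc n) m\<bar>) * b (Suc n) m)"
      unfolding mix_def
      by (intro sum_mono mult_right_mono b0)
        (auto intro: order_trans[OF abs_triangle_ineq] simp: abs_mult)
    also have "\<dots> = \<bar>s\<bar> * (\<Sum>m=1..M. \<bar>A (Suc n) m\<bar> * b (Suc n) m)
        + \<bar>1 - s\<bar> * (\<Sum>m=1..M. \<bar>B (Suc n) m\<bar> * b (Suc n) m)"
      by (simp add: sum_distrib_left sum.distrib[symmetric] algebra_simps)
    finally show "norm (\<Sum>m=1..M. \<bar>mix s A B (Suc n) m\<bar> * b (Suc n) m) \<le> \<dots>" .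
  qed
  with 1 A B show ?thesis
    unfolding critic_settings_def by (auto simp: mix_def)
qed

context
  fixes M :: nat and \<xi> \<xi>' :: "nat \<Rightarrow> nat \<Rightarrow> real \<Rightarrow> real" and b :: "nat \<Rightarrow> nat \<Rightarrow> real"
    and P :: "real measure" and A :: "nat \<Rightarrow> nat \<Rightarrow> real"
  assumes deriv: "\<And>n m x. 1 \<le> n \<Longrightarrow> 1 \<le> m \<Longrightarrow> m \<le> M \<Longrightarrow> x \<in> {-1..1} \<Longrightarrow>
        (\<xi> n m has_real_derivative \<xi>' n m x) (at x within {-1..1})"
    and deriv_le: "\<And>n m x. 1 \<le> n \<Longrightarrow> 1 \<le> m \<Longrightarrow> m \<le> M \<Longrightarrow> x \<in> {-1..1} \<Longrightarrow> \<bar>\<xi>' n m x\<bar> \<le> b n m"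
    and P: "real_distribution P"
    and A: "A \<in> critic_settings M \<xi> b"
begin

private definition part :: "nat \<Rightarrow> real \<Rightarrow> real" where
  "part N x = (\<Sum>n<N. \<Sum>m=1..M. A (Suc n) m * \<xi> (Suc n) m x)"

private lemma xi_lipschitz:
  assumes "1 \<le> n" "1 \<le> m" "m \<le> M" "x \<in> {-1..1}"
  shows "\<bar>\<xi> n m x - \<xi> n m 0\<bar> \<le> b n m"
proof -
  have "norm (\<xi> n m x - \<xi> n m 0) \<le> b n m * norm (x - 0)"
    by (rule field_differentiable_bound[where S = "{-1..1}" and f' = "\<xi>' n m"])
      (use assms deriv deriv_le in auto)
  also have "\<dots> \<le> b n m * 1"
    using assms deriv_le[of n m x] by (intro mult_left_mono) auto
  finally show ?thesis by simp
qed

private lemma continuous_xi: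
  "1 \<le> n \<Longrightarrow> 1 \<le> m \<Longrightarrow> m \<le> M \<Longrightarrow> continuous_on {-1..1} (\<xi> n m)"
  unfolding continuous_on_eq_continuous_within using deriv by (blast intro: DERIV_continuous)

private lemma xi_integrable:
  assumes "1 \<le> n" "1 \<le> m" "m \<le> M"
  shows "set_integrable P {-1..1} (\<xi> n m)"
proof -
  interpret real_distribution P by (rule P)
  have "compact (\<xi> n m ` {-1..1})"
    using continuous_xi[OF assms] by (intro compact_continuous_image) auto
  then obtain C where C: "\<And>x. x \<in> {-1..1} \<Longrightarrow> \<bar>\<xi> n m x\<bar> \<le> C"
    by (metis compact_imp_bounded bounded_iff imageI real_norm_def)
  have "(\<lambda>x. indicator {-1..1} x *\<^sub>R \<xi> n m x) \<in> borel_measurable borel"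
    using continuous_xi[OF assms] by (intro borel_measurable_continuous_on_indicator) auto
  moreover have "0 \<le> C" using C[of 0] by auto
  ultimately show ?thesis
    unfolding set_integrable_def
    by (intro integrable_const_bound[where B = C])
      (use C in \<open>auto simp: indicator_def split: if_splits\<close>)
qed

private lemma part_integral:
  "set_integrable P {-1..1} (part N)"
  "(LINT x:{-1..1}|P. part N x)
     = (\<Sum>n<N. \<Sum>m=1..M. A (Suc n) m * expect P (\<xi> (Suc n) m))"
proof -
  have *: "integrable P (\<lambda>x. indicator {-1..1} x *\<^sub>R (A (Suc n) m * \<xi> (Suc n) m x))"
    "integral\<^sup>L P (\<lambda>x. indicator {-1..1} x *\<^sub>R (A (Suc n) m * \<xi> (Suc n) m x))
       = A (Suc n) m * expect P (\<xi> (Suc n) m)"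
    if "m \<in> {1..M}" for n m
    using xi_integrable[of "Suc n" m] that
    by (auto simp: set_integrable_def expect_def set_lebesgue_integral_def mult.left_commute)
  show "set_integrable P {-1..1} (part N)"
    unfolding set_integrable_def part_def scaleR_sum_right by (intro Bochner_Integration.integrable_sum *)
  show "(LINT x:{-1..1}|P. part N x)
     = (\<Sum>n<N. \<Sum>m=1..M. A (Suc n) m * expect P (\<xi> (Suc n) m))"
    unfolding set_lebesgue_integral_def part_def scaleR_sum_right
    using * by (simp only: Bochner_Integration.integral_sum Bochner_Integration.integrable_sum
        cong: sum.cong)
qed

private lemma part_lim: "x \<in> {-1..1} \<Longrightarrow> (\<lambda>N. part N x) \<longlonglongrightarrow> critic M \<xi> A x"
  using A unfolding critic_settings_def part_def critic_def
  by (auto intro!: summable_LIMSEQ)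

private lemma part_bound: obtains C where "\<And>N x. x \<in> {-1..1} \<Longrightarrow> \<bar>part N x\<bar> \<le> C"
proof -
  have b0: "0 \<le> b n m" if "1 \<le> n" "1 \<le> m" "m \<le> M" for n m
    using deriv_le[OF that, of 0] by auto
  have "Bseq (\<lambda>N. part N 0)"
    using part_lim[of 0] by (auto intro: convergent_imp_Bseq convergentI)
  then obtain C where C: "\<And>N. \<bar>part N 0\<bar> \<le> C" by (auto simp: Bseq_def)
  have "\<bar>part N x\<bar> \<le> C + lip_surrogate M b A" if x: "x \<in> {-1..1}" for N x
  proof -
    have "part N x - part N 0
        = (\<Sum>n<N. \<Sum>m=1..M. A (Suc n) m * (\<xi> (Suc n) m x - \<xi> (Suc n) m 0))"
      by (simp add: part_def sum_subtractf algebra_simps)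
    also have "\<bar>\<dots>\<bar> \<le> (\<Sum>n<N. \<Sum>m=1..M. \<bar>A (Suc n) m\<bar> * b (Suc n) m)"
      by (intro order_trans[OF sum_abs] sum_mono)
        (use x in \<open>auto simp: abs_mult intro!: mult_left_mono xi_lipschitz\<close>)
    also have "\<dots> \<le> lip_surrogate M b A"
      unfolding lip_surrogate_def
      using A by (intro sum_le_suminf) (auto simp: critic_settings_def intro!: sum_nonneg mult_nonneg_nonneg b0)
    finally show ?thesis using C[of N] by linarith
  qed
  then show ?thesis by (rule that)
qed

private lemma critic_dominated:
  "set_integrable P {-1..1} (critic M \<xi> A)"
  "(\<lambda>N. LINT x:{-1..1}|P. part N x) \<longlonglongrightarrow> expect P (critic M \<xi> A)"
proof -
  interpret real_distribution P by (rule P)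
  obtain C where C: "\<And>N x. x \<in> {-1..1} \<Longrightarrow> \<bar>part N x\<bar> \<le> C" using part_bound by blast
  have C0: "0 \<le> C" using C[of 0 0] by auto
  let ?s = "\<lambda>N x. indicator {-1..1} x *\<^sub>R part N x"
  let ?f = "\<lambda>x. indicator {-1..1} x *\<^sub>R critic M \<xi> A x"
  have lim: "(\<lambda>N. ?s N x) \<longlonglongrightarrow> ?f x" for x
    using part_lim[of x] by (cases "x \<in> {-1..1}") (auto simp: indicator_def)
  have s: "?s N \<in> borel_measurable P" for N
    using part_integral(1)[of N] unfolding set_integrable_def by auto
  have f: "?f \<in> borel_measurable P"
    using lim s by (rule borel_measurable_LIMSEQ_metric[rotated])
  note dc = f s integrable_const[of C]
  have bd: "AE x in P. norm (?s N x) \<le> C" for N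
    using C C0 by (intro AE_I2) (auto simp: indicator_def)
  show "set_integrable P {-1..1} (critic M \<xi> A)"
    unfolding set_integrable_def
    by (rule integrable_dominated_convergence[where s = ?s, OF dc _ bd]) (intro AE_I2 lim)
  show "(\<lambda>N. LINT x:{-1..1}|P. part N x) \<longlonglongrightarrow> expect P (critic M \<xi> A)"
    unfolding expect_def set_lebesgue_integral_def
    by (rule integral_dominated_convergence[where s = ?s, OF dc _ bd]) (intro AE_I2 lim)
qed

lemma integrable_critic: "set_integrable P {-1..1} (critic M \<xi> A)"
  by (rule critic_dominated)

lemma expect_critic_sums:
  "(\<lambda>n. \<Sum>m=1..M. A (Suc n) m * expect P (\<xi> (Suc n) m)) sums expect P (critic M \<xi> A)"
  using critic_dominated(2) unfolding sums_def part_integral(2) .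

end

lemma critic_objective_sums:
  fixes \<xi> \<xi>' :: "nat \<Rightarrow> nat \<Rightarrow> real \<Rightarrow> real"
  assumes "\<And>n m x. 1 \<le> n \<Longrightarrow> 1 \<le> m \<Longrightarrow> m \<le> M \<Longrightarrow> x \<in> {-1..1} \<Longrightarrow>
        (\<xi> n m has_real_derivative \<xi>' n m x) (at x within {-1..1})"
    and "\<And>n m x. 1 \<le> n \<Longrightarrow> 1 \<le> m \<Longrightarrow> m \<le> M \<Longrightarrow> x \<in> {-1..1} \<Longrightarrow> \<bar>\<xi>' n m x\<bar> \<le> b n m"
    and "real_distribution P\<^sub>r" and "real_distribution P\<^sub>g"
    and "A \<in> critic_settings M \<xi> b"
  shows "(\<lambda>n. \<Sum>m=1..M. A (Suc n) m * (expect P\<^sub>r (\<xi> (Suc n) m) - expect P\<^sub>g (\<xi> (Suc n) m)))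
    sums critic_objective M \<xi> P\<^sub>r P\<^sub>g A"
  using sums_diff[OF expect_critic_sums[OF assms(1,2,3,5)] expect_critic_sums[OF assms(1,2,4,5)]]
  unfolding critic_objective_def by (simp add: sum_subtractf right_diff_distrib)

end

theory Submission
  imports Defs
begin

text \<open>This is the principle that a local maximum of an affine function on a convex set is
  global. The feasible set is convex because \<open>lip_surrogate\<close> is a weighted l1 seminorm
  (\<open>lip_surrogate_mix_le\<close>, \<open>mix_in_feasible_settings\<close>), and the objective
  is affine along segments (\<open>critic_objective_mix\<close>). Given a local maximum B and a
  feasible A, the points \<open>mix (1 / t) A B\<close> tend to B by the assumption on the topology.
  For large t such a point is therefore feasible and lies in the neighbourhood where B is optimal,
  so (1/t) J(A) + (1 - 1/t) J(B) \<le> J(B). Cancelling and multiplying by t > 0 gives J(A) \<le>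
  J(B).\<close>

lemma lip_surrogate_mix_le:
  assumes A: "A \<in> critic_settings M \<xi> b" and B: "B \<in> critic_settings M \<xi> b"
    and b0: "\<And>n m. 1 \<le> n \<Longrightarrow> 1 \<le> m \<Longrightarrow> m \<le> M \<Longrightarrow> 0 \<le> b n m"
    and s: "0 \<le> s" "s \<le> 1"
  shows "lip_surrogate M b (mix s A B) \<le> s * lip_surrogate M b A + (1 - s) * lip_surrogate M b B"
proof -
  let ?l = "\<lambda>C n. \<Sum>m=1..M. \<bar>C (Suc n) m\<bar> * b (Suc n) m"
  have summ: "summable (?l A)" "summable (?l B)" "summable (?l (mix s A B))"
    using A B mix_in_critic_settings[OF A B b0] unfolding critic_settings_def by auto
  have "?l (mix s A B) n \<le> s * ?l A n + (1 - s) * ?l B n" for n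
  proof -
    have "?l (mix s A B) n
        \<le> (\<Sum>m=1..M. (s * \<bar>A (Suc n) m\<bar> + (1 - s) * \<bar>B (Suc n) m\<bar>) * b (Suc n) m)"
      unfolding mix_def using s
      by (intro sum_mono mult_right_mono b0 order_trans[OF abs_triangle_ineq]) (auto simp: abs_mult)
    also have "\<dots> = s * ?l A n + (1 - s) * ?l B n"
      by (simp add: sum_distrib_left sum.distrib[symmetric] algebra_simps)
    finally show ?thesis .
  qed
  \<comment> \<open>The termwise triangle inequality passes to the series because all three
    converge; for the mixture this is closure of \<open>critic_settings\<close> under
    \<open>mix\<close>.\<close>
  then have "suminf (?l (mix s A B)) \<le> (\<Sum>n. s * ?l A n + (1 - s) * ?l B n)"
    using summ by (intro suminf_le summable_add summable_mult)
  also have "\<dots> = s * suminf (?l A) + (1 - s) * suminf (?l B)"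
    using summ by (simp add: suminf_add[symmetric] summable_mult suminf_mult)
  finally show ?thesis
    unfolding lip_surrogate_def .
qed

text \<open>Convexity of the feasible set: it is the sublevel set at 1 of a convex function on
  \<open>critic_settings\<close>.\<close>

lemma mix_in_feasible_settings:
  assumes A: "A \<in> feasible_settings M \<xi> b" and B: "B \<in> feasible_settings M \<xi> b"
    and b0: "\<And>n m. 1 \<le> n \<Longrightarrow> 1 \<le> m \<Longrightarrow> m \<le> M \<Longrightarrow> 0 \<le> b n m"
    and s: "0 \<le> s" "s \<le> 1"
  shows "mix s A B \<in> feasible_settings M \<xi> b"
proof -
  have AB: "A \<in> critic_settings M \<xi> b" "B \<in> critic_settings M \<xi> b"
    "lip_surrogate M b A \<le> 1" "lip_surrogate M b B \<le> 1"
    using A B by (auto simp: feasible_settings_def)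
  have "lip_surrogate M b (mix s A B) \<le> s * lip_surrogate M b A + (1 - s) * lip_surrogate M b B"
    using AB(1,2) b0 s by (rule lip_surrogate_mix_le)
  also have "\<dots> \<le> 1"
    using AB(3,4) s by (intro convex_bound_le) auto
  finally show ?thesis
    using mix_in_critic_settings[OF AB(1,2) b0] by (auto simp: feasible_settings_def)
qed

text \<open>The objective is defined by integrals of an infinite series.
  \<open>critic_objective_sums\<close> rewrites it as a convergent series linear in the
  coefficients, so affinity, for every real s, follows from uniqueness of sums.\<close>

lemma critic_objective_mix:
  fixes \<xi> \<xi>' :: "nat \<Rightarrow> nat \<Rightarrow> real \<Rightarrow> real"
  assumes deriv: "\<And>n m x. 1 \<le> n \<Longrightarrow> 1 \<le> m \<Longrightarrow> m \<le> M \<Longrightarrow> x \<in> {-1..1} \<Longrightarrow>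
        (\<xi> n m has_real_derivative \<xi>' n m x) (at x within {-1..1})"
    and deriv_le: "\<And>n m x. 1 \<le> n \<Longrightarrow> 1 \<le> m \<Longrightarrow> m \<le> M \<Longrightarrow> x \<in> {-1..1} \<Longrightarrow> \<bar>\<xi>' n m x\<bar> \<le> b n m"
    and P: "real_distribution P\<^sub>r" "real_distribution P\<^sub>g"
    and A: "A \<in> critic_settings M \<xi> b" and B: "B \<in> critic_settings M \<xi> b"
  shows "critic_objective M \<xi> P\<^sub>r P\<^sub>g (mix s A B)
    = s * critic_objective M \<xi> P\<^sub>r P\<^sub>g A + (1 - s) * critic_objective M \<xi> P\<^sub>r P\<^sub>g B"
proof -
  have "mix s A B \<in> critic_settings M \<xi> b"
    \<comment> \<open>Nonnegativity of b comes from the derivative bound at the sample point 0: 0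
      \<le> \<bar>\<xi>' n m 0\<bar> \<le> b n m.\<close>
    using A B by (rule mix_in_critic_settings) (use deriv_le[of _ _ 0] in \<open>auto intro: order_trans[OF abs_ge_zero]\<close>)
  have sums: "(\<lambda>n. \<Sum>m=1..M. C (Suc n) m * (expect P\<^sub>r (\<xi> (Suc n) m) - expect P\<^sub>g (\<xi> (Suc n) m)))
      sums critic_objective M \<xi> P\<^sub>r P\<^sub>g C" if "C \<in> critic_settings M \<xi> b" for C
    using deriv deriv_le P that by (rule critic_objective_sums)
  note AB = sums_add[OF sums_mult[OF sums[OF A], of s] sums_mult[OF sums[OF B], of "1 - s"]]
  have "(\<lambda>n. \<Sum>m=1..M. mix s A B (Suc n) m * (expect P\<^sub>r (\<xi> (Suc n) m) - expect P\<^sub>g (\<xi> (Suc n) m)))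
    sums (s * critic_objective M \<xi> P\<^sub>r P\<^sub>g A + (1 - s) * critic_objective M \<xi> P\<^sub>r P\<^sub>g B)"
    using AB unfolding mix_def sum_distrib_left sum.distrib[symmetric] distrib_right mult.assoc .
  with sums[OF \<open>mix s A B \<in> _\<close>] show ?thesis
    by (rule sums_unique2)
qed

theorem theorem1:
  fixes M :: nat
    and \<xi> \<xi>' :: "nat \<Rightarrow> nat \<Rightarrow> real \<Rightarrow> real"
    and b :: "nat \<Rightarrow> nat \<Rightarrow> real"
    and P\<^sub>r P\<^sub>g :: "real measure"
    and T :: "(nat \<Rightarrow> nat \<Rightarrow> real) topology"
    and B :: "nat \<Rightarrow> nat \<Rightarrow> real"
  assumes "M \<ge> 1"
    and "\<And>n m x. 1 \<le> n \<Longrightarrow> 1 \<le> m \<Longrightarrow> m \<le> M \<Longrightarrow> x \<in> {-1..1} \<Longrightarrow> \<bar>\<xi> n m x\<bar> \<le> 1"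
    and "\<And>n m x. 1 \<le> n \<Longrightarrow> 1 \<le> m \<Longrightarrow> m \<le> M \<Longrightarrow> x \<in> {-1..1} \<Longrightarrow>
           (\<xi> n m has_real_derivative \<xi>' n m x) (at x within {-1..1})"
    and "\<And>n m x. 1 \<le> n \<Longrightarrow> 1 \<le> m \<Longrightarrow> m \<le> M \<Longrightarrow> x \<in> {-1..1} \<Longrightarrow> \<bar>\<xi>' n m x\<bar> \<le> b n m"
    and "real_distribution P\<^sub>r" and "AE x in P\<^sub>r. x \<in> {-1..1}"
    and "real_distribution P\<^sub>g" and "AE x in P\<^sub>g. x \<in> {-1..1}"
    and "topspace T = critic_settings M \<xi> b"
    and "\<And>A C. A \<in> critic_settings M \<xi> b \<Longrightarrow> C \<in> critic_settings M \<xi> b \<Longrightarrow>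
           limitin T (\<lambda>t::real. mix (1 / t) A C) C at_top"
    and "local_max_on T (feasible_settings M \<xi> b) (critic_objective M \<xi> P\<^sub>r P\<^sub>g) B"
  shows "global_max_on (feasible_settings M \<xi> b) (critic_objective M \<xi> P\<^sub>r P\<^sub>g) B"
proof -
  let ?S = "feasible_settings M \<xi> b" and ?J = "critic_objective M \<xi> P\<^sub>r P\<^sub>g"
  have b0: "0 \<le> b n m" if "1 \<le> n" "1 \<le> m" "m \<le> M" for n m
    using assms(4)[OF that, of 0] by auto
  obtain U where U: "openin T U" "B \<in> U" "\<And>A. A \<in> U \<Longrightarrow> A \<in> ?S \<Longrightarrow> ?J A \<le> ?J B"
    and B: "B \<in> ?S"
    using assms(11) unfolding local_max_on_def by blast
  have "?J A \<le> ?J B" if A: "A \<in> ?S" for A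
  proof -
    have AB: "A \<in> critic_settings M \<xi> b" "B \<in> critic_settings M \<xi> b"
      using A B by (auto simp: feasible_settings_def)
    have "\<forall>\<^sub>F t::real in at_top. mix (1 / t) A B \<in> U"
      using assms(10)[OF AB] U(1,2) unfolding limitin_def by blast
    \<comment> \<open>Requiring t \<ge> 1 puts the weight 1/t in (0, 1]: at most 1 for feasibility
      of the mixture, positive for the final cancellation.\<close>
    then have "\<forall>\<^sub>F t::real in at_top. mix (1 / t) A B \<in> U \<and> 1 \<le> t"
      using eventually_ge_at_top by (rule eventually_conj)
    then obtain t :: real where t: "mix (1 / t) A B \<in> U" "1 \<le> t"
      by (auto dest: eventually_happens)
    have "mix (1 / t) A B \<in> ?S"
      using A B b0 t(2) by (intro mix_in_feasible_settings) auto
    with U(3) t(1) have "?J (mix (1 / t) A B) \<le> ?J B"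
      by blast
    moreover have "?J (mix (1 / t) A B) = 1 / t * ?J A + (1 - 1 / t) * ?J B"
      using assms(3,4,5,7) AB by (rule critic_objective_mix)
    \<comment> \<open>The share (1 - 1/t) J(B) is subtracted from both sides.\<close>
    ultimately have "1 / t * ?J A \<le> 1 / t * ?J B"
      by (simp add: algebra_simps)
    then show ?thesis
      using t(2) by (simp add: divide_le_cancel)
  qed
  with B show ?thesis
    by (simp add: global_max_on_def)
qed

end
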